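(* Let $T\in B_1(\mathbb D)$ be a contraction. Assume that $T$ is unitarily equivalent to the operator $M^*$ on $(\mathcal H,K)$ for some non-negative definite kernel $K$ on the unit disc $\mathbb D$. Then $$K^2(z,w)\preceq \mathbb S_{\mathbb D}^{-2}(z,w)\,\mathcal G_{K^{-1}}(z,w),$$ that is, the matrix $$\Big(\mathbb S_{\mathbb D}^{-2}(w_i,w_j)\,\mathcal G_{K^{-1}}(w_i,w_j)-K^2(w_i,w_j)\Big)_{i,j=1}^n$$ is non-negative definite for every finite subset $\{w_1,\ldots,w_n\}$ of $\mathbb D$ and every $n\in\mathbb N$.
   Context: $\mathbb D$ is the open unit disc in $\mathbb C$. A bounded operator $T$ on a separable Hilbert space $\mathcal H$ is in the Cowen-Douglas class $B_1(\mathbb D)$ if for all $w\in\mathbb D$ one has $\dim\ker(T-w)=1$ and $\operatorname{ran}(T-w)$ is closed, and the closed linear span of $\bigcup_{w\in\mathbb D}\ker(T-w)$ is $\mathcal H$. It is a contraction if $\|T\|\le 1$. All kernels are assumed sesqui-analytic: $K:\mathbb D\times\mathbb D\to\mathbb C$, $K(z,w)$ is holomorphic in $z$ and anti-holomorphic in $w$. A kernel $K$ is non-negative definite (written $K\succeq 0$) if $(K(x_i,x_j))_{i,j=1}^p$ is a non-negative definite matrix for every finite set $\{x_1,\dots,x_p\}$; $K_1\preceq K_2$ means $K_2-K_1\succeq0$. $(\mathcal H,K)$ denotes the reproducing kernel Hilbert space (of holomorphic functions on $\mathbb D$) with reproducing kernel $K$, and $M$ is the (bounded) operator of multiplication by the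 coordinate function $z$ on it. $\mathbb S_{\mathbb D}(z,w)=\frac{1}{1-z\bar w}$ is the Szegő kernel, so $\mathbb S_{\mathbb D}^{-2}(z,w)=(1-z\bar w)^2$. The Gaussian curvature kernel is $$\mathcal G_{K^{-1}}(z,w)=K(z,w)\,\partial\bar\partial K(z,w)-\partial K(z,w)\,\bar\partial K(z,w),$$ where $\partial=\frac{\partial}{\partial z}$ and $\bar\partial=\frac{\partial}{\partial\bar w}$. *)

theory Defs
  imports "HOL-Analysis.Analysis" "HOL-Library.Function_Algebras"
begin

section \<open>Complex Hilbert spaces on a carrier set\<close>

text \<open>
  A reproducing kernel Hilbert space depends on its kernel, so it cannot be a type. Hilbert spaces
  are therefore given by a carrier, which is a linear subspace of an ambient complex vector space;
  the addition is the one of the ambient type. Inner products are linear in the first argument.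
\<close>

record 'a hilb =
  carrier :: "'a set"
  smult :: "complex \<Rightarrow> 'a \<Rightarrow> 'a"
  ip :: "'a \<Rightarrow> 'a \<Rightarrow> complex"

definition hnorm :: "'a hilb \<Rightarrow> 'a \<Rightarrow> real" where
  "hnorm H x = sqrt (Re (ip H x x))"

text \<open>
  The value 0 off the carrier is arbitrary; it is there because \<open>Metric_space\<close> demands a non-negative
  and symmetric function on the whole type.
\<close>
definition hdist :: "('a::ab_group_add) hilb \<Rightarrow> 'a \<Rightarrow> 'a \<Rightarrow> real" where
  "hdist H x y = (if x \<in> carrier H \<and> y \<in> carrier H then hnorm H (x - y) else 0)"

definition htopology :: "('a::ab_group_add) hilb \<Rightarrow> 'a topology" where
  "htopology H = Metric_space.mtopology (carrier H) (hdist H)"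

locale complex_hilbert_space = vector_space "smult H"
  for H :: "('a::ab_group_add) hilb" +
  assumes carrier_subspace: "subspace (carrier H)"
    and ip_add_left: "\<lbrakk>x \<in> carrier H; y \<in> carrier H; z \<in> carrier H\<rbrakk>
           \<Longrightarrow> ip H (x + y) z = ip H x z + ip H y z"
    and ip_smult_left: "\<lbrakk>x \<in> carrier H; y \<in> carrier H\<rbrakk> \<Longrightarrow> ip H (smult H c x) y = c * ip H x y"
    and ip_cnj: "\<lbrakk>x \<in> carrier H; y \<in> carrier H\<rbrakk> \<Longrightarrow> ip H y x = cnj (ip H x y)"
    and ip_nonneg: "x \<in> carrier H \<Longrightarrow> ip H x x \<in> \<real>\<^sub>\<ge>\<^sub>0"
    and ip_definite: "\<lbrakk>x \<in> carrier H; ip H x x = 0\<rbrakk> \<Longrightarrow> x = 0"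
    and complete: "Metric_space.mcomplete (carrier H) (hdist H)"


section \<open>Operators\<close>

definition linear_between ::
    "('a::ab_group_add) hilb \<Rightarrow> ('b::ab_group_add) hilb \<Rightarrow> ('a \<Rightarrow> 'b) \<Rightarrow> bool" where
  "linear_between H1 H2 A \<longleftrightarrow> A \<in> carrier H1 \<rightarrow> carrier H2 \<and>
     (\<forall>x\<in>carrier H1. \<forall>y\<in>carrier H1. A (x + y) = A x + A y) \<and>
     (\<forall>c. \<forall>x\<in>carrier H1. A (smult H1 c x) = smult H2 c (A x))"

definition bounded_operator :: "('a::ab_group_add) hilb \<Rightarrow> ('a \<Rightarrow> 'a) \<Rightarrow> bool" where
  "bounded_operator H A \<longleftrightarrow> linear_between H H A \<and>
     (\<exists>C. \<forall>x\<in>carrier H. hnorm H (A x) \<le> C * hnorm H x)"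

text \<open>Only meaningful for bounded operators, since it is a supremum of reals.\<close>
definition operator_norm :: "'a hilb \<Rightarrow> ('a \<Rightarrow> 'a) \<Rightarrow> real" where
  "operator_norm H A = (SUP x\<in>{x \<in> carrier H. hnorm H x \<le> 1}. hnorm H (A x))"

definition contraction :: "('a::ab_group_add) hilb \<Rightarrow> ('a \<Rightarrow> 'a) \<Rightarrow> bool" where
  "contraction H A \<longleftrightarrow> bounded_operator H A \<and> operator_norm H A \<le> 1"

definition adjoint_op :: "'a hilb \<Rightarrow> ('a \<Rightarrow> 'a) \<Rightarrow> 'a \<Rightarrow> 'a" where
  "adjoint_op H A y = (THE z. z \<in> carrier H \<and> (\<forall>x\<in>carrier H. ip H (A x) y = ip H x z))"

definition unitary_between ::
    "('a::ab_group_add) hilb \<Rightarrow> ('b::ab_group_add) hilb \<Rightarrow> ('a \<Rightarrow> 'b) \<Rightarrow> bool" where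
  "unitary_between H1 H2 U \<longleftrightarrow> linear_between H1 H2 U \<and> bij_betw U (carrier H1) (carrier H2) \<and>
     (\<forall>x\<in>carrier H1. \<forall>y\<in>carrier H1. ip H2 (U x) (U y) = ip H1 x y)"

definition unitarily_equivalent ::
    "('a::ab_group_add) hilb \<Rightarrow> ('a \<Rightarrow> 'a) \<Rightarrow> ('b::ab_group_add) hilb \<Rightarrow> ('b \<Rightarrow> 'b) \<Rightarrow> bool" where
  "unitarily_equivalent H1 A1 H2 A2 \<longleftrightarrow>
     (\<exists>U. unitary_between H1 H2 U \<and> (\<forall>x\<in>carrier H1. U (A1 x) = A2 (U x)))"


section \<open>The Cowen-Douglas class of rank one over the disc\<close>

abbreviation unit_disc :: "complex set" (\<open>\<bbbD>\<close>) where
  "\<bbbD> \<equiv> ball 0 1"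

definition shift_op :: "('a::ab_group_add) hilb \<Rightarrow> ('a \<Rightarrow> 'a) \<Rightarrow> complex \<Rightarrow> 'a \<Rightarrow> 'a" where
  "shift_op H T w x = T x - smult H w x"

definition ker_op :: "('a::ab_group_add) hilb \<Rightarrow> ('a \<Rightarrow> 'a) \<Rightarrow> 'a set" where
  "ker_op H A = {x \<in> carrier H. A x = 0}"

definition cowen_douglas_B1 :: "('a::ab_group_add) hilb \<Rightarrow> ('a \<Rightarrow> 'a) \<Rightarrow> bool" where
  "cowen_douglas_B1 H T \<longleftrightarrow> bounded_operator H T \<and>
     (\<forall>w\<in>\<bbbD>. vector_space.dim (smult H) (ker_op H (shift_op H T w)) = 1 \<and>
             closedin (htopology H) (shift_op H T w ` carrier H)) \<and>
     htopology H closure_of (module.span (smult H) (\<Union>w\<in>\<bbbD>. ker_op H (shift_op H T w))) = carrier H"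


section \<open>Kernels on the disc\<close>

definition sesqui_analytic :: "(complex \<Rightarrow> complex \<Rightarrow> complex) \<Rightarrow> bool" where
  "sesqui_analytic K \<longleftrightarrow>
     (\<forall>w\<in>\<bbbD>. (\<lambda>z. K z w) holomorphic_on \<bbbD>) \<and> (\<forall>z\<in>\<bbbD>. (\<lambda>w. cnj (K z w)) holomorphic_on \<bbbD>)"

text \<open>
  Non-negative definiteness of the complex matrix \<open>A\<close> indexed by the finite set \<open>I\<close>. Requiring the
  quadratic form to be real and non-negative for all complex vectors forces \<open>A\<close> to be Hermitian.
\<close>
definition nonneg_definite_matrix :: "'i set \<Rightarrow> ('i \<Rightarrow> 'i \<Rightarrow> complex) \<Rightarrow> bool" where
  "nonneg_definite_matrix I A \<longleftrightarrow>
     (\<forall>c :: 'i \<Rightarrow> complex. (\<Sum>i\<in>I. \<Sum>j\<in>I. cnj (c i) * A i j * c j) \<in> \<real>\<^sub>\<ge>\<^sub>0)"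

definition nonneg_definite_kernel :: "(complex \<Rightarrow> complex \<Rightarrow> complex) \<Rightarrow> bool" where
  "nonneg_definite_kernel K \<longleftrightarrow>
     (\<forall>X. finite X \<and> X \<subseteq> \<bbbD> \<longrightarrow> nonneg_definite_matrix X (\<lambda>x y. K x y))"

definition kernel_le ::
    "(complex \<Rightarrow> complex \<Rightarrow> complex) \<Rightarrow> (complex \<Rightarrow> complex \<Rightarrow> complex) \<Rightarrow> bool"
    (infix \<open>\<preceq>\<close> 50) where
  "K1 \<preceq> K2 \<longleftrightarrow> nonneg_definite_kernel (\<lambda>z w. K2 z w - K1 z w)"

definition szego_kernel :: "complex \<Rightarrow> complex \<Rightarrow> complex" where
  "szego_kernel z w = 1 / (1 - z * cnj w)"

definition del :: "(complex \<Rightarrow> complex \<Rightarrow> complex) \<Rightarrow> complex \<Rightarrow> complex \<Rightarrow> complex" where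
  "del K z w = deriv (\<lambda>u. K u w) z"

text \<open>
  The derivative with respect to the conjugate of the second variable: if \<open>K z w = g (cnj w)\<close> with
  \<open>g\<close> holomorphic, it is \<open>deriv g (cnj w)\<close>, and \<open>g u = K z (cnj u)\<close>.
\<close>
definition delbar :: "(complex \<Rightarrow> complex \<Rightarrow> complex) \<Rightarrow> complex \<Rightarrow> complex \<Rightarrow> complex" where
  "delbar K z w = deriv (\<lambda>u. K z (cnj u)) (cnj w)"

text \<open>This is the kernel written $\mathcal G_{K^{-1}}$ in the literature.\<close>
definition curvature_kernel ::
    "(complex \<Rightarrow> complex \<Rightarrow> complex) \<Rightarrow> complex \<Rightarrow> complex \<Rightarrow> complex" where
  "curvature_kernel K z w = K z w * del (delbar K) z w - del K z w * delbar K z w"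


section \<open>Reproducing kernel Hilbert spaces\<close>

text \<open>
  Functions on the disc are represented by total functions that vanish outside of it.
\<close>
definition restrict_disc :: "(complex \<Rightarrow> complex) \<Rightarrow> complex \<Rightarrow> complex" where
  "restrict_disc f z = (if z \<in> \<bbbD> then f z else 0)"

definition is_rkhs ::
    "(complex \<Rightarrow> complex \<Rightarrow> complex) \<Rightarrow> (complex \<Rightarrow> complex) hilb \<Rightarrow> bool" where
  "is_rkhs K F \<longleftrightarrow> complex_hilbert_space F \<and>
     smult F = (\<lambda>c f z. c * f z) \<and>
     (\<forall>f\<in>carrier F. f holomorphic_on \<bbbD> \<and> restrict_disc f = f) \<and>
     (\<forall>w\<in>\<bbbD>. restrict_disc (\<lambda>z. K z w) \<in> carrier F \<and>
        (\<forall>f\<in>carrier F. ip F f (restrict_disc (\<lambda>z. K z w)) = f w))"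

definition mult_z :: "(complex \<Rightarrow> complex) \<Rightarrow> complex \<Rightarrow> complex" where
  "mult_z f z = z * f z"

end

theory Submission
  imports Defs "HOL-Complex_Analysis.Cauchy_Integral_Formula"
begin

text \<open>
  Write $A = M^*$. Since $T$ is a contraction, so is $A$, and therefore
  $[x, y] = \langle x, y\rangle - \langle Ax, Ay\rangle$ is a non-negative form on the reproducing
  kernel space. Let $k_w$ be the vector representing evaluation at $w$ and $d_w$ the vector
  representing evaluation of the derivative at $w$. Then $A k_w = \bar w k_w$, and dualising the
  product rule $(zf)' = f + z f'$ gives $A d_w = k_w + \bar w d_w$. Consequently the form $[\cdot,\cdot]$
  on these vectors yields the kernel $L(z,w) = (1 - z\bar w) K(z,w)$ and its derivatives:
  $[k_w, k_z] = L$, $[d_w, k_z] = \bar\partial L$, $[k_w, d_z] = \partial L$ and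
  $[d_w, d_z] = \partial\bar\partial L$.

  The Gaussian curvature kernel behaves like a second logarithmic derivative under products, and the
  Szego kernel $S$ satisfies $\partial\bar\partial \log S = S^2$. Applied to $K = S L$ this gives
  \[ S^{-2}\,\mathcal G_{K^{-1}} - K^2
     = L\,\partial\bar\partial L - \partial L\,\bar\partial L , \]
  a polynomial identity that needs no division by $L$. The right-hand side is the
  2-by-2 minor of the Gram matrix of $[\cdot,\cdot]$ with rows $k_z, d_z$ and columns $k_w, d_w$.
  A family of such minors of a non-negative definite matrix is itself non-negative definite
  (\<open>nonneg_definite_matrix_minors\<close>), because up to a factor of 2 it is the Gram matrix of
  the antisymmetric tensors $k_w \otimes d_w - d_w \otimes k_w$.

  The one analytic point is the existence of $d_w$ (\<open>derivative_evaluation_vector\<close>). The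
  difference quotients $(k_{w+h} - k_w)/\bar h$ represent the functionals $f \mapsto (f(w+h)-f(w))/h$;
  since every $f$ is holomorphic, their differences divided by $h$ are pointwise bounded, hence
  bounded in norm by the uniform boundedness principle, and so along $h = r\,2^{-n}$ the quotients
  form a Cauchy sequence.
\<close>

section \<open>Hilbert space geometry\<close>

context complex_hilbert_space
begin

lemma zero_in_carrier: "0 \<in> carrier H"
  using carrier_subspace by (rule subspace_0)

lemma add_in_carrier: "x \<in> carrier H \<Longrightarrow> y \<in> carrier H \<Longrightarrow> x + y \<in> carrier H"
  using carrier_subspace by (rule subspace_add)

lemma diff_in_carrier: "x \<in> carrier H \<Longrightarrow> y \<in> carrier H \<Longrightarrow> x - y \<in> carrier H"
  using carrier_subspace by (rule subspace_diff)

lemma smult_in_carrier: "x \<in> carrier H \<Longrightarrow> smult H c x \<in> carrier H"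
  using carrier_subspace by (rule subspace_scale)

lemma sum_in_carrier: "(\<And>i. i \<in> I \<Longrightarrow> f i \<in> carrier H) \<Longrightarrow> (\<Sum>i\<in>I. f i) \<in> carrier H"
  using carrier_subspace by (rule subspace_sum)

lemmas in_carrier = zero_in_carrier add_in_carrier diff_in_carrier smult_in_carrier sum_in_carrier

lemma ip_add_right:
  assumes "x \<in> carrier H" "y \<in> carrier H" "z \<in> carrier H"
  shows "ip H x (y + z) = ip H x y + ip H x z"
  using assms ip_add_left[of y z x] ip_cnj[of _ x]
  by (metis add_in_carrier complex_cnj_add)

lemma ip_smult_right:
  assumes "x \<in> carrier H" "y \<in> carrier H"
  shows "ip H x (smult H c y) = cnj c * ip H x y"
  using assms ip_smult_left[of y x c] ip_cnj[of _ x]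
  by (metis smult_in_carrier complex_cnj_mult)

lemma ip_diff_left:
  assumes "x \<in> carrier H" "y \<in> carrier H" "z \<in> carrier H"
  shows "ip H (x - y) z = ip H x z - ip H y z"
  using ip_add_left[of "x - y" y z] assms by (simp add: diff_in_carrier)

lemma ip_diff_right:
  assumes "x \<in> carrier H" "y \<in> carrier H" "z \<in> carrier H"
  shows "ip H x (y - z) = ip H x y - ip H x z"
  using ip_add_right[of x "y - z" z] assms by (simp add: diff_in_carrier)

lemma ip_zero_left: "x \<in> carrier H \<Longrightarrow> ip H 0 x = 0"
  using ip_diff_left[of x x x] by simp

lemma ip_zero_right: "x \<in> carrier H \<Longrightarrow> ip H x 0 = 0"
  using ip_diff_right[of x x x] by simp

lemma ip_sum_left:
  assumes "\<And>i. i \<in> I \<Longrightarrow> f i \<in> carrier H" "x \<in> carrier H"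
  shows "ip H (\<Sum>i\<in>I. f i) x = (\<Sum>i\<in>I. ip H (f i) x)"
  using assms
proof (induction I rule: infinite_finite_induct)
  case (insert a I)
  then show ?case by (simp add: ip_add_left sum_in_carrier)
qed (auto simp: ip_zero_left)

lemma ip_sum_right:
  assumes "\<And>i. i \<in> I \<Longrightarrow> f i \<in> carrier H" "x \<in> carrier H"
  shows "ip H x (\<Sum>i\<in>I. f i) = (\<Sum>i\<in>I. ip H x (f i))"
  using assms
proof (induction I rule: infinite_finite_induct)
  case (insert a I)
  then show ?case by (simp add: ip_add_right sum_in_carrier)
qed (auto simp: ip_zero_right)

lemma ip_self: 
  assumes "x \<in> carrier H" shows "ip H x x = of_real ((hnorm H x)\<^sup>2)"
proof -
  obtain r where "ip H x x = of_real r" "r \<ge> 0"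
    using ip_nonneg[OF assms] by (auto elim: nonneg_Reals_cases)
  then show ?thesis by (simp add: hnorm_def)
qed

lemma hnorm_nonneg: 
  assumes "x \<in> carrier H" shows "0 \<le> hnorm H x"
  using ip_nonneg[OF assms] by (auto simp: hnorm_def complex_nonneg_Reals_iff)

lemma hnorm_eq_0_iff: "x \<in> carrier H \<Longrightarrow> hnorm H x = 0 \<longleftrightarrow> x = 0"
  using ip_self[of x] ip_definite[of x] ip_zero_left[of 0] zero_in_carrier by auto

lemma hnorm_zero: "hnorm H 0 = 0"
  using hnorm_eq_0_iff zero_in_carrier by blast

lemma hnorm_smult:
  assumes "x \<in> carrier H" shows "hnorm H (smult H c x) = cmod c * hnorm H x"
proof -
  have "cnj c * c = (of_real (cmod c))\<^sup>2"
    by (metis complex_norm_square mult.commute of_real_power)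
  then have "ip H (smult H c x) (smult H c x) = of_real ((cmod c * hnorm H x)\<^sup>2)"
    using assms by (simp add: ip_smult_left ip_smult_right in_carrier ip_self[OF assms]
        power_mult_distrib mult_ac)
  then show ?thesis
    using assms by (simp add: hnorm_def[of H "smult H c x"] hnorm_nonneg)
qed

lemma hnorm_minus_commute: 
  assumes "x \<in> carrier H" "y \<in> carrier H" shows "hnorm H (x - y) = hnorm H (y - x)"
proof -
  have "ip H (x - y) (x - y) = ip H (y - x) (y - x)"
    using assms by (simp add: ip_diff_left ip_diff_right in_carrier)
  then show ?thesis by (simp add: hnorm_def)
qed

lemma Cauchy_Schwarz:
  assumes x: "x \<in> carrier H" and y: "y \<in> carrier H"
  shows "cmod (ip H x y) \<le> hnorm H x * hnorm H y"
proof (cases "y = 0")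
  case True
  then show ?thesis using x by (simp add: ip_zero_right hnorm_zero)
next
  case False
  then have n: "hnorm H y > 0"
    using y hnorm_nonneg[OF y] hnorm_eq_0_iff[OF y] by linarith
  \<comment> \<open>\<open>z\<close> is the component of \<open>x\<close> orthogonal to \<open>y\<close>.\<close>
  define c where "c = ip H x y / of_real ((hnorm H y)\<^sup>2)"
  define z where "z = x - smult H c y"
  have z: "z \<in> carrier H" using x y by (simp add: z_def in_carrier)
  have "ip H z z = of_real ((hnorm H x)\<^sup>2) - cnj c * ip H x y - c * ip H y x + c * cnj c * of_real ((hnorm H y)\<^sup>2)"
    unfolding z_def using x y
    by (simp add: ip_diff_left ip_diff_right ip_smult_left ip_smult_right in_carrier ip_self[OF x] ip_self[OF y] algebra_simps)
  also have "\<dots> = of_real ((hnorm H x)\<^sup>2) - ip H x y * cnj (ip H x y) / of_real ((hnorm H y)\<^sup>2)"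
    using n ip_cnj[OF x y] by (simp add: c_def field_simps)
  also have "\<dots> = of_real ((hnorm H x)\<^sup>2 - (cmod (ip H x y))\<^sup>2 / (hnorm H y)\<^sup>2)"
    by (simp only: complex_norm_square[symmetric] of_real_diff of_real_divide)
  finally have "of_real ((hnorm H x)\<^sup>2 - (cmod (ip H x y))\<^sup>2 / (hnorm H y)\<^sup>2) \<in> (\<real>\<^sub>\<ge>\<^sub>0 :: complex set)"
    using ip_nonneg[OF z] by metis
  then have "0 \<le> (hnorm H x)\<^sup>2 - (cmod (ip H x y))\<^sup>2 / (hnorm H y)\<^sup>2"
    by (simp only: nonneg_Reals_of_real_iff)
  then have "(cmod (ip H x y))\<^sup>2 \<le> (hnorm H x * hnorm H y)\<^sup>2"
    using n by (simp add: field_simps)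
  then show ?thesis
    using x y by (simp add: abs_le_square_iff[symmetric] abs_mult hnorm_nonneg)
qed

lemma hnorm_triangle:
  assumes x: "x \<in> carrier H" and y: "y \<in> carrier H"
  shows "hnorm H (x + y) \<le> hnorm H x + hnorm H y"
proof -
  have "(hnorm H (x + y))\<^sup>2 = Re (ip H (x + y) (x + y))"
    using x y by (simp add: ip_self in_carrier)
  also have "\<dots> = (hnorm H x)\<^sup>2 + (hnorm H y)\<^sup>2 + Re (ip H x y) + Re (ip H y x)"
    using x y by (simp add: ip_add_left ip_add_right in_carrier ip_self[OF x] ip_self[OF y])
  also have "Re (ip H y x) = Re (ip H x y)" using ip_cnj[OF x y] by simp
  also have "Re (ip H x y) \<le> hnorm H x * hnorm H y"
    using Cauchy_Schwarz[OF x y] complex_Re_le_cmod[of "ip H x y"] by linarith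
  finally have "(hnorm H (x + y))\<^sup>2 \<le> (hnorm H x + hnorm H y)\<^sup>2"
    by (simp add: power2_sum)
  then show ?thesis
    by (rule power2_le_imp_le) (use x y in \<open>simp add: hnorm_nonneg\<close>)
qed

lemma Metric_space_hdist: "Metric_space (carrier H) (hdist H)"
proof
  fix x y z
  show "0 \<le> hdist H x y" by (simp add: hdist_def hnorm_nonneg in_carrier)
  show "hdist H x y = hdist H y x" by (simp add: hdist_def hnorm_minus_commute)
  assume x: "x \<in> carrier H" and y: "y \<in> carrier H"
  show "hdist H x y = 0 \<longleftrightarrow> x = y"
    using x y by (simp add: hdist_def hnorm_eq_0_iff in_carrier)
  assume z: "z \<in> carrier H"
  show "hdist H x z \<le> hdist H x y + hdist H y z"
    using x y z hnorm_triangle[of "x - y" "y - z"] by (simp add: hdist_def in_carrier)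
qed

text \<open>
  The Baire category proof of the Banach-Steinhaus theorem, for the functionals \<open>f \<mapsto> ip H f (y n)\<close>:
  the closed sets on which all of them are bounded by \<open>m\<close> cover the space, so one of them contains
  a ball, and testing at the points of the ball in the direction of \<open>y n\<close> bounds the norm.
\<close>
lemma uniform_boundedness:
  fixes y :: "nat \<Rightarrow> 'a"
  assumes y: "\<And>n. y n \<in> carrier H"
    and bdd: "\<And>f. f \<in> carrier H \<Longrightarrow> bounded (range (\<lambda>n. ip H f (y n)))"
  shows "\<exists>C. \<forall>n. hnorm H (y n) \<le> C"
proof -
  interpret M: Metric_space "carrier H" "hdist H" by (rule Metric_space_hdist)
  define S where "S m = {f \<in> carrier H. \<forall>n. cmod (ip H f (y n)) \<le> real m}" for m :: nat
  have closed: "closedin M.mtopology (S m)" for m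
    unfolding M.closedin_metric
  proof (intro conjI allI impI)
    show "S m \<subseteq> carrier H" by (auto simp: S_def)
    fix f assume f: "f \<in> carrier H - S m"
    then obtain n where n: "cmod (ip H f (y n)) > real m" by (auto simp: S_def not_le)
    define r where "r = (cmod (ip H f (y n)) - m) / (hnorm H (y n) + 1)"
    have p: "hnorm H (y n) \<ge> 0" using y by (rule hnorm_nonneg)
    have r: "r > 0" using n p by (simp add: r_def)
    have "g \<notin> S m" if g: "g \<in> M.mball f r" for g
    proof -
      have gH: "g \<in> carrier H" and d: "hnorm H (f - g) < r"
        using g f by (auto simp: hdist_def)
      have "cmod (ip H f (y n)) - cmod (ip H g (y n)) \<le> cmod (ip H (f - g) (y n))"
        using f gH y by (simp add: ip_diff_left norm_triangle_ineq2)
      also have "\<dots> \<le> hnorm H (f - g) * hnorm H (y n)"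
        using f gH y by (intro Cauchy_Schwarz) (auto simp: in_carrier)
      also have "\<dots> \<le> r * hnorm H (y n)" using d p by (intro mult_right_mono) auto
      also have "\<dots> < r * (hnorm H (y n) + 1)" using r by simp
      also have "\<dots> = cmod (ip H f (y n)) - m" using p by (simp add: r_def)
      finally show ?thesis by (auto simp: S_def not_le)
    qed
    then show "\<exists>r>0. disjnt (S m) (M.mball f r)"
      using r by (auto simp: disjnt_def intro!: exI[of _ r])
  qed
  have cover: "(\<Union>m. S m) = carrier H"
  proof (intro equalityI subsetI)
    fix f assume f: "f \<in> carrier H"
    then obtain B where B: "\<And>n. cmod (ip H f (y n)) \<le> B"
      using bdd[of f] by (auto simp: bounded_iff)
    obtain m :: nat where "B \<le> real m" using real_arch_simple by blast
    then show "f \<in> (\<Union>m. S m)"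
      using f B by (auto simp: S_def intro!: exI[of _ m] order_trans[OF B])
  qed (auto simp: S_def)
  obtain m where "M.mtopology interior_of (S m) \<noteq> {}"
  proof (rule ccontr)
    assume "\<not> thesis"
    then have "\<And>m. M.mtopology interior_of (S m) = {}" using that by blast
    then have "M.mtopology interior_of (\<Union>(range S)) = {}"
      using closed by (intro M.metric_Baire_category_alt) (auto simp: complete)
    then show False
      using cover zero_in_carrier
      by (metis M.topspace_mtopology interior_of_topspace empty_iff)
  qed
  then obtain f e where f: "f \<in> carrier H" and e: "e > 0" and sub: "M.mball f e \<subseteq> S m"
    by (auto simp: M.in_interior_of_mball)
  \<comment> \<open>Moving from the centre \<open>f\<close> by \<open>e / 2\<close> in the direction of \<open>y n\<close> stays in the ball and
     changes the inner product with \<open>y n\<close> by \<open>e / 2\<close> times its norm; both values are at most \<open>m\<close>.\<close>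
  have "hnorm H (y n) \<le> 4 * real m / e" for n
  proof (cases "y n = 0")
    case True
    then show ?thesis using e by (simp add: hnorm_zero)
  next
    case False
    then have p: "hnorm H (y n) > 0"
      using hnorm_nonneg[OF y] hnorm_eq_0_iff[OF y] by (metis less_eq_real_def)
    define t where "t = e / (2 * hnorm H (y n))"
    have t: "t > 0" using e p by (simp add: t_def)
    define g where "g = f + smult H (of_real t) (y n)"
    have gH: "g \<in> carrier H" using f y by (simp add: g_def in_carrier)
    have "hnorm H (f - g) = hnorm H (smult H (of_real t) (y n))"
      using f gH y by (subst hnorm_minus_commute) (auto simp: g_def)
    also have "\<dots> = e / 2" using t p y by (simp add: hnorm_smult) (simp add: t_def)
    finally have "g \<in> M.mball f e" using f gH e by (simp add: hdist_def)
    then have 1: "cmod (ip H g (y n)) \<le> m" using sub by (auto simp: S_def)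
    have "f \<in> S m" using f e by (intro subsetD[OF sub]) auto
    then have 2: "cmod (ip H f (y n)) \<le> m" by (simp add: S_def)
    have "ip H g (y n) = ip H f (y n) + of_real (t * (hnorm H (y n))\<^sup>2)"
      using f y by (simp add: g_def ip_add_left ip_smult_left in_carrier ip_self)
    then have "of_real (t * (hnorm H (y n))\<^sup>2) = ip H g (y n) - ip H f (y n)" by simp
    then have "cmod (of_real (t * (hnorm H (y n))\<^sup>2)) \<le> m + m"
      using norm_triangle_ineq4[of "ip H g (y n)" "ip H f (y n)"] 1 2 by simp
    then have "t * (hnorm H (y n))\<^sup>2 \<le> 2 * m" unfolding norm_of_real by linarith
    moreover have "t * (hnorm H (y n))\<^sup>2 = e * hnorm H (y n) / 2"
      using p by (simp add: t_def power2_eq_square)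
    ultimately show ?thesis using e by (simp add: field_simps)
  qed
  then show ?thesis by blast
qed

text \<open>
  The sequence is Cauchy and converges in norm; what is recorded is only the convergence of inner
  products, which identifies the functional that the limit represents.
\<close>
lemma weak_limit_of_geometric_increments:
  fixes x :: "nat \<Rightarrow> 'a"
  assumes x: "\<And>n. x n \<in> carrier H"
    and inc: "\<And>n. hnorm H (x n - x (Suc n)) \<le> C * (1/2) ^ n"
  shows "\<exists>l\<in>carrier H. \<forall>f\<in>carrier H. (\<lambda>n. ip H f (x n)) \<longlonglongrightarrow> ip H f l"
proof -
  interpret M: Metric_space "carrier H" "hdist H" by (rule Metric_space_hdist)
  have C: "C \<ge> 0"
    using order_trans[OF hnorm_nonneg inc[of 0]] x by (simp add: in_carrier)
  have step: "hnorm H (x m - x (m + k)) \<le> C * (2 - 2 * (1/2)^k) * (1/2) ^ m" for m k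
  proof (induction k)
    case 0
    then show ?case by (simp add: hnorm_zero)
  next
    case (Suc k)
    have "hnorm H (x m - x (m + Suc k)) \<le> hnorm H (x m - x (m + k)) + hnorm H (x (m + k) - x (Suc (m + k)))"
      using hnorm_triangle[of "x m - x (m + k)" "x (m + k) - x (Suc (m + k))"] x
      by (simp add: in_carrier)
    also have "\<dots> \<le> C * (2 - 2 * (1/2)^k) * (1/2) ^ m + C * (1/2)^(m + k)"
      using Suc inc[of "m + k"] by linarith
    also have "\<dots> = C * (2 - 2 * (1/2)^Suc k) * (1/2) ^ m"
      by (simp add: algebra_simps power_add)
    finally show ?case .
  qed
  have bd: "hnorm H (x m - x n) \<le> 2 * C * (1/2) ^ N" if "N \<le> m" "m \<le> n" for m n N
  proof -
    have "hnorm H (x m - x n) \<le> C * (2 - 2 * (1/2)^(n - m)) * (1/2) ^ m"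
      using step[of m "n - m"] that by simp
    also have "\<dots> \<le> C * 2 * (1/2) ^ m"
      using C by (intro mult_right_mono mult_left_mono) auto
    also have "\<dots> \<le> C * 2 * (1/2) ^ N"
      using C that by (intro mult_left_mono power_decreasing) auto
    finally show ?thesis by simp
  qed
  have "M.MCauchy x"
    unfolding M.MCauchy_def
  proof (intro conjI allI impI)
    show "range x \<subseteq> carrier H" using x by auto
    fix e :: real assume e: "e > 0"
    have "(\<lambda>N. 2 * C * (1/2) ^ N) \<longlonglongrightarrow> 2 * C * 0"
      by (intro tendsto_mult tendsto_const LIMSEQ_power_zero) auto
    then obtain N where N: "2 * C * (1/2) ^ N < e"
      using e by (metis (no_types, lifting) eventually_happens' mult_zero_right order_tendstoD(2) sequentially_bot)
    have "hdist H (x m) (x n) < e" if "N \<le> m" "N \<le> n" for m n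
    proof (cases "m \<le> n")
      case True
      then show ?thesis using bd[of N m n] that N x by (simp add: hdist_def)
    next
      case False
      then show ?thesis using bd[of N n m] that N x 
        by (simp add: hdist_def hnorm_minus_commute[of "x m"])
    qed
    then show "\<exists>N. \<forall>n n'. N \<le> n \<longrightarrow> N \<le> n' \<longrightarrow> hdist H (x n) (x n') < e" by blast
  qed
  then obtain l where "limitin M.mtopology x l sequentially"
    using complete by (auto simp: M.mcomplete_def)
  then have l: "l \<in> carrier H" and lim: "(\<lambda>n. hdist H (x n) l) \<longlonglongrightarrow> 0"
    by (auto simp: M.limitin_metric_dist_null)
  have "(\<lambda>n. ip H f (x n)) \<longlonglongrightarrow> ip H f l" if f: "f \<in> carrier H" for f
  proof (rule LIM_zero_cancel, rule Lim_null_comparison)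
    show "\<forall>\<^sub>F n in sequentially. cmod (ip H f (x n) - ip H f l) \<le> hnorm H f * hdist H (x n) l"
      using f l x Cauchy_Schwarz[of f "x _ - l"]
      by (simp add: ip_diff_right in_carrier hdist_def)
    show "(\<lambda>n. hnorm H f * hdist H (x n) l) \<longlonglongrightarrow> 0"
      using tendsto_mult[OF tendsto_const lim] by simp
  qed
  then show ?thesis using l by blast
qed

end

section \<open>Minors of non-negative definite matrices\<close>

lemma nonneg_definite_matrix_subset:
  assumes "nonneg_definite_matrix I A" "J \<subseteq> I" "finite I"
  shows "nonneg_definite_matrix J A"
  unfolding nonneg_definite_matrix_def
proof
  fix c :: "'a \<Rightarrow> complex"
  define d where "d i = (if i \<in> J then c i else 0)" for i
  have "(\<Sum>i\<in>J. \<Sum>j\<in>J. cnj (c i) * A i j * c j) = (\<Sum>i\<in>J. \<Sum>j\<in>J. cnj (d i) * A i j * d j)"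
    by (intro sum.cong) (auto simp: d_def)
  also have "\<dots> = (\<Sum>i\<in>J. \<Sum>j\<in>I. cnj (d i) * A i j * d j)"
    using assms by (intro sum.cong refl sum.mono_neutral_left) (auto simp: d_def)
  also have "\<dots> = (\<Sum>i\<in>I. \<Sum>j\<in>I. cnj (d i) * A i j * d j)"
    using assms by (intro sum.mono_neutral_left) (auto simp: d_def)
  finally show "(\<Sum>i\<in>J. \<Sum>j\<in>J. cnj (c i) * A i j * c j) \<in> \<real>\<^sub>\<ge>\<^sub>0"
    using assms by (simp add: nonneg_definite_matrix_def)
qed

lemma nonneg_definite_matrix_diag:
  assumes "nonneg_definite_matrix I A" "finite I" "i \<in> I"
  shows "A i i \<in> \<real>\<^sub>\<ge>\<^sub>0"
proof -
  have "nonneg_definite_matrix {i} A"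
    using assms by (intro nonneg_definite_matrix_subset[OF assms(1)]) auto
  then have "cnj ((\<lambda>_. 1) i) * A i i * (\<lambda>_. 1) i \<in> \<real>\<^sub>\<ge>\<^sub>0"
    unfolding nonneg_definite_matrix_def by (elim allE[of _ "\<lambda>_. 1"]) simp
  then show ?thesis by simp
qed

text \<open>
  The quadratic form on vectors supported on two indices is real; the vectors \<open>(1,1)\<close> and \<open>(1,\<i>)\<close>
  give the imaginary and the real part of the claim.
\<close>
lemma nonneg_definite_matrix_hermitian:
  assumes "nonneg_definite_matrix I A" "finite I" "i \<in> I" "j \<in> I"
  shows "A j i = cnj (A i j)"
proof (cases "i = j")
  case True
  then show ?thesis
    using nonneg_definite_matrix_diag[OF assms(1-3)] 
    by (auto elim: nonneg_Reals_cases)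
next
  case False
  have ij: "nonneg_definite_matrix {i, j} A"
    using assms by (intro nonneg_definite_matrix_subset[OF assms(1)]) auto
  have q: "Im (cnj x * A i i * x + cnj x * A i j * y + cnj y * A j i * x + cnj y * A j j * y) = 0" for x y
    using ij False unfolding nonneg_definite_matrix_def
    by (elim allE[of _ "\<lambda>k. if k = i then x else y"])
       (auto simp: complex_nonneg_Reals_iff algebra_simps)
  show ?thesis
    using q[of 1 0] q[of 0 1] q[of 1 1] q[of 1 \<i>] by (simp add: complex_eq_iff)
qed

text \<open>
  Otherwise the quadratic form, which is linear in the coordinate \<open>a\<close> when \<open>A a a = 0\<close>, could be made
  negative by a large value of that coordinate.
\<close>
lemma nonneg_definite_matrix_zero_row:
  assumes "nonneg_definite_matrix I A" "finite I" "a \<in> I" "j \<in> I" "A a a = 0"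
  shows "A a j = 0"
proof (cases "a = j")
  case False
  have ij: "nonneg_definite_matrix {a, j} A"
    using assms by (intro nonneg_definite_matrix_subset[OF assms(1)]) auto
  have h: "A j a = cnj (A a j)" using nonneg_definite_matrix_hermitian assms by metis
  have q: "0 \<le> Re (cnj x * A a j * y + cnj y * A j a * x + cnj y * A j j * y)" for x y
    using ij False unfolding nonneg_definite_matrix_def
    by (elim allE[of _ "\<lambda>k. if k = a then x else y"])
       (auto simp: complex_nonneg_Reals_iff algebra_simps \<open>A a a = 0\<close>)
  \<comment> \<open>The test vector has coordinate \<open>- t\<close> at \<open>a\<close> and \<open>cnj (A a j)\<close> at \<open>j\<close>.\<close>
  define r where "r = (cmod (A a j))\<^sup>2"
  define t where "t = Re (A j j) + 1"
  have d: "Re (A j j) \<ge> 0"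
    using nonneg_definite_matrix_diag[OF assms(1,2,4)] by (simp add: complex_nonneg_Reals_iff)
  have "0 \<le> Re (- of_real t * A a j * cnj (A a j) + A a j * A j a * (- of_real t) + A a j * A j j * cnj (A a j))"
    using q[of "- of_real t" "cnj (A a j)"] by simp
  also have "\<dots> = r * (Re (A j j) - 2 * t)"
    by (simp add: r_def h cmod_def power2_eq_square algebra_simps)
  finally have "r * (Re (A j j) + 2) \<le> 0" by (simp add: t_def algebra_simps)
  then have "r = 0" using d by (simp add: r_def mult_le_0_iff)
  then show ?thesis by (simp add: r_def)
qed (use assms in simp)

text \<open>
  Cholesky factorization: with \<open>u\<close> the column \<open>a\<close> of \<open>A\<close> divided by the square root of the
  diagonal entry, subtracting the rank-one matrix of \<open>u\<close> clears row and column \<open>a\<close> and leaves the Schur complement, which is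
  again non-negative definite. The factors are indexed by \<open>I\<close> itself.
\<close>
lemma nonneg_definite_matrix_Gram:
  assumes "finite I" "nonneg_definite_matrix I A"
  shows "\<exists>(v :: 'i \<Rightarrow> 'i \<Rightarrow> complex). \<forall>i\<in>I. \<forall>j\<in>I. A i j = (\<Sum>k\<in>I. v k i * cnj (v k j))"
  using assms
proof (induction I arbitrary: A rule: finite_induct)
  case (insert a I)
  let ?J = "insert a I"
  have fin: "finite ?J" using insert by simp
  note A = insert.prems
  define s where "s = sqrt (Re (A a a))"
  have diag: "A a a = of_real (s\<^sup>2)" "s \<ge> 0"
    using nonneg_definite_matrix_diag[OF A fin, of a]
    by (auto simp: s_def complex_nonneg_Reals_iff complex_eq_iff)
  \<comment> \<open>If \<open>s = 0\<close> then \<open>u = 0\<close>, since division by zero gives zero; row and column \<open>a\<close> of \<open>A\<close> then vanish as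
     well, so subtracting the rank-one matrix of \<open>u\<close> clears them in this case too.\<close>
  define u where "u i = A i a / of_real s" for i
  define B where "B i j = A i j - u i * cnj (u j)" for i j
  have herm: "A a i = cnj (A i a)" if "i \<in> ?J" for i
    using nonneg_definite_matrix_hermitian[OF A fin that] by blast
  have zero: "A i a = 0" if "s = 0" "i \<in> ?J" for i
    using nonneg_definite_matrix_zero_row[OF A fin _ that(2), of a] herm[OF that(2)] diag that(1) by simp
  have row: "u i * cnj (u a) = A i a" if "i \<in> ?J" for i
    using diag zero[OF _ that] by (cases "s = 0") (auto simp: u_def power2_eq_square)
  have uu: "cnj (u a) * u a = A a a" using row[of a] by (simp add: mult.commute)
  have B: "nonneg_definite_matrix I B"
    unfolding nonneg_definite_matrix_def
  proof
    fix c :: "'i \<Rightarrow> complex"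
    define S where "S = (\<Sum>j\<in>I. cnj (u j) * c j)"
    \<comment> \<open>The value at \<open>a\<close> that minimizes the quadratic form of \<open>A\<close> for given values on \<open>I\<close>; the
       minimum is the quadratic form of the Schur complement.\<close>
    define t where "t = - S / of_real s"
    define d where "d = c(a := t)"
    have ne: "k \<in> I \<Longrightarrow> k \<noteq> a" for k using insert.hyps by auto
    have r1: "(\<Sum>j\<in>I. A a j * c j) = of_real s * S"
      unfolding S_def sum_distrib_left
      by (intro sum.cong refl) (use zero herm in \<open>cases "s = 0"; auto simp: u_def\<close>)
    have r2: "(\<Sum>i\<in>I. cnj (c i) * A i a) = of_real s * cnj S"
      unfolding S_def sum_distrib_left cnj_sum
      by (intro sum.cong refl) (use zero in \<open>cases "s = 0"; auto simp: u_def\<close>)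
    have "(\<Sum>i\<in>?J. \<Sum>j\<in>?J. cnj (d i) * A i j * d j) = 
       cnj t * A a a * t + cnj t * (\<Sum>j\<in>I. A a j * c j) + ((\<Sum>i\<in>I. cnj (c i) * A i a) * t
         + (\<Sum>i\<in>I. \<Sum>j\<in>I. cnj (c i) * A i j * c j))"
      using insert.hyps ne
      by (auto simp: d_def sum.distrib sum_distrib_left sum_distrib_right mult.assoc intro!: sum.cong arg_cong2[of _ _ _ _ "(+)"])
    also have "\<dots> = (\<Sum>i\<in>I. \<Sum>j\<in>I. cnj (c i) * A i j * c j) - cnj S * S"
    proof (cases "s = 0")
      case True
      have "S = 0" by (simp add: S_def u_def True)
      then show ?thesis by (simp add: t_def)
    next
      case False
      then show ?thesis by (simp add: r1 r2 diag(1) t_def power2_eq_square)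
    qed
    finally have Q: "(\<Sum>i\<in>?J. \<Sum>j\<in>?J. cnj (d i) * A i j * d j) = 
       (\<Sum>i\<in>I. \<Sum>j\<in>I. cnj (c i) * A i j * c j) - cnj S * S" .
    have "(\<Sum>i\<in>I. \<Sum>j\<in>I. cnj (c i) * B i j * c j) = 
          (\<Sum>i\<in>I. \<Sum>j\<in>I. cnj (c i) * A i j * c j) - cnj S * S"
    proof -
      have "cnj S * S = (\<Sum>i\<in>I. \<Sum>j\<in>I. cnj (c i) * (u i * cnj (u j)) * c j)"
        unfolding S_def cnj_sum sum_product by (intro sum.cong refl) (simp add: mult_ac)
      then show ?thesis
        by (simp add: B_def sum_subtractf[symmetric] ring_distribs)
    qed
    also have "\<dots> = (\<Sum>i\<in>?J. \<Sum>j\<in>?J. cnj (d i) * A i j * d j)"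
      by (rule Q[symmetric])
    finally show "(\<Sum>i\<in>I. \<Sum>j\<in>I. cnj (c i) * B i j * c j) \<in> \<real>\<^sub>\<ge>\<^sub>0"
      using A unfolding nonneg_definite_matrix_def by simp
  qed
  obtain v :: "'i \<Rightarrow> 'i \<Rightarrow> complex" where v: "\<And>i j. i \<in> I \<Longrightarrow> j \<in> I \<Longrightarrow> B i j = (\<Sum>k\<in>I. v k i * cnj (v k j))"
    using insert.IH[OF B] by blast
  define v' where "v' k i = (if k = a then u i else if i = a then 0 else v k i)" for k i
  have "A i j = (\<Sum>k\<in>?J. v' k i * cnj (v' k j))" if "i \<in> ?J" "j \<in> ?J" for i j
  proof -
    have ne: "k \<in> I \<Longrightarrow> k \<noteq> a" for k using insert.hyps by auto
    have "(\<Sum>k\<in>?J. v' k i * cnj (v' k j)) = u i * cnj (u j) + (\<Sum>k\<in>I. v' k i * cnj (v' k j))"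
      using insert.hyps by (simp add: v'_def)
    also have "(\<Sum>k\<in>I. v' k i * cnj (v' k j)) = (if i = a \<or> j = a then 0 else B i j)"
      using that ne by (auto simp: v'_def v intro!: sum.cong)
    also have "u i * cnj (u j) + (if i = a \<or> j = a then 0 else B i j) = A i j"
    proof (cases "i = a \<or> j = a")
      case True
      have "u a * cnj (u j) = cnj (u j * cnj (u a))" by (simp add: mult.commute)
      then have "u a * cnj (u j) = A a j" using row[OF that(2)] herm[OF that(2)] by simp
      then show ?thesis using True row[OF that(1)] by auto
    qed (simp add: B_def)
    finally show ?thesis by simp
  qed
  then show ?case by blast
qed simp

text \<open>
  A restriction of the second compound matrix of \<open>A\<close>. If \<open>A\<close> is the Gram matrix of vectors with
  coordinates \<open>v k\<close>, then by Lagrange's identity the minors are half the Gram matrix of the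
  antisymmetric tensors with coordinates \<open>w k l\<close> (Cauchy-Binet for two rows).
\<close>
lemma nonneg_definite_matrix_minors:
  assumes "finite I" "nonneg_definite_matrix I A" "p ` X \<subseteq> I" "q ` X \<subseteq> I"
  shows "nonneg_definite_matrix X (\<lambda>x y. A (p x) (p y) * A (q x) (q y) - A (p x) (q y) * A (q x) (p y))"
proof -
  obtain v where v: "\<And>i j. i \<in> I \<Longrightarrow> j \<in> I \<Longrightarrow> A i j = (\<Sum>k\<in>I. v k i * cnj (v k j))"
    using nonneg_definite_matrix_Gram[OF assms(1,2)] by blast
  define w where "w k l x = v k (p x) * v l (q x) - v k (q x) * v l (p x)" for k l x
  have minor: "A (p x) (p y) * A (q x) (q y) - A (p x) (q y) * A (q x) (p y) =
     (\<Sum>k\<in>I. \<Sum>l\<in>I. w k l x * cnj (w k l y)) / 2" if "x \<in> X" "y \<in> X" for x y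
  proof -
    have pq: "p x \<in> I" "p y \<in> I" "q x \<in> I" "q y \<in> I" using that assms by auto
    let ?S = "\<lambda>a b c d. \<Sum>k\<in>I. \<Sum>l\<in>I. (v k a * cnj (v k b)) * (v l c * cnj (v l d))"
    have S: "A a b * A c d = ?S a b c d" if "a \<in> I" "b \<in> I" "c \<in> I" "d \<in> I" for a b c d
      using that by (simp add: v sum_product)
    have "(\<Sum>k\<in>I. \<Sum>l\<in>I. w k l x * cnj (w k l y)) =
       ?S (p x) (p y) (q x) (q y) - ?S (p x) (q y) (q x) (p y)
       - ?S (q x) (p y) (p x) (q y) + ?S (q x) (q y) (p x) (p y)"
      unfolding w_def sum_subtractf[symmetric] sum.distrib[symmetric]
      by (intro sum.cong refl) (simp add: algebra_simps)
    also have "\<dots> = 2 * (A (p x) (p y) * A (q x) (q y) - A (p x) (q y) * A (q x) (p y))"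
      using pq by (simp only: S[symmetric]) (simp add: algebra_simps)
    finally show ?thesis by simp
  qed
  show ?thesis
    unfolding nonneg_definite_matrix_def
  proof
    fix c :: "_ \<Rightarrow> complex"
    define g where "g k l = (\<Sum>x\<in>X. cnj (c x) * w k l x)" for k l
    have "(\<Sum>x\<in>X. \<Sum>y\<in>X. cnj (c x) * (A (p x) (p y) * A (q x) (q y) - A (p x) (q y) * A (q x) (p y)) * c y) =
       (\<Sum>x\<in>X. \<Sum>y\<in>X. \<Sum>k\<in>I. \<Sum>l\<in>I. (cnj (c x) * w k l x) * cnj (cnj (c y) * w k l y) / 2)"
      by (intro sum.cong refl) (simp add: minor sum_distrib_left sum_distrib_right sum_divide_distrib mult_ac)
    also have "\<dots> = (\<Sum>x\<in>X. \<Sum>k\<in>I. \<Sum>y\<in>X. \<Sum>l\<in>I. (cnj (c x) * w k l x) * cnj (cnj (c y) * w k l y) / 2)"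
      by (intro sum.cong refl sum.swap)
    also have "\<dots> = (\<Sum>k\<in>I. \<Sum>x\<in>X. \<Sum>y\<in>X. \<Sum>l\<in>I. (cnj (c x) * w k l x) * cnj (cnj (c y) * w k l y) / 2)"
      by (rule sum.swap)
    also have "\<dots> = (\<Sum>k\<in>I. \<Sum>x\<in>X. \<Sum>l\<in>I. \<Sum>y\<in>X. (cnj (c x) * w k l x) * cnj (cnj (c y) * w k l y) / 2)"
      by (intro sum.cong refl sum.swap)
    also have "\<dots> = (\<Sum>k\<in>I. \<Sum>l\<in>I. \<Sum>x\<in>X. \<Sum>y\<in>X. (cnj (c x) * w k l x) * cnj (cnj (c y) * w k l y) / 2)"
      by (intro sum.cong refl sum.swap)
    also have "\<dots> = (\<Sum>k\<in>I. \<Sum>l\<in>I. g k l * cnj (g k l) / 2)"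
      by (intro sum.cong refl) (simp add: g_def sum_product sum_divide_distrib)
    also have "\<dots> = (\<Sum>k\<in>I. \<Sum>l\<in>I. of_real ((cmod (g k l))\<^sup>2 / 2))"
      by (intro sum.cong refl) (simp add: complex_norm_square[symmetric])
    also have "\<dots> = of_real (\<Sum>k\<in>I. \<Sum>l\<in>I. (cmod (g k l))\<^sup>2 / 2)" by simp
    also have "\<dots> \<in> \<real>\<^sub>\<ge>\<^sub>0" unfolding nonneg_Reals_of_real_iff by (intro sum_nonneg) auto
    finally show "(\<Sum>x\<in>X. \<Sum>y\<in>X. cnj (c x) * (A (p x) (p y) * A (q x) (q y) - A (p x) (q y) * A (q x) (p y)) * c y) \<in> \<real>\<^sub>\<ge>\<^sub>0" .
  qed
qed

section \<open>Vectors representing evaluations\<close>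

text \<open>
  The difference quotient of \<open>f\<close> at \<open>w\<close> extends holomorphically over \<open>w\<close>, so it differs from its
  value there by a multiple of \<open>h\<close> plus a smaller error. The constant depends on \<open>f\<close>,
  which is why the uniform boundedness principle is needed afterwards.
\<close>
lemma holomorphic_difference_quotient_increments:
  fixes h :: "nat \<Rightarrow> complex"
  assumes f: "f holomorphic_on S" "open S" "w \<in> S"
    and h: "h \<longlonglongrightarrow> 0" "\<And>n. h n \<noteq> 0" "\<And>n. h (Suc n) = h n / 2"
  shows "bounded (range (\<lambda>n. ((f (w + h n) - f w) / h n - (f (w + h (Suc n)) - f w) / h (Suc n)) / h n))"
    and "(\<lambda>n. (f (w + h n) - f w) / h n) \<longlonglongrightarrow> deriv f w"
proof -
  define q where "q z = (if z = w then deriv f w else (f z - f w) / (z - w))" for z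
  have qh: "q (w + h n) = (f (w + h n) - f w) / h n" for n using h by (simp add: q_def)
  have "q holomorphic_on S" unfolding q_def using f(1,2) by (rule pole_lemma_open)
  then obtain d where d: "(q has_field_derivative d) (at w)"
    using f by (meson holomorphic_derivI)
  have lim: "(\<lambda>n. (q (w + h n) - q w) / h n) \<longlonglongrightarrow> d"
  proof -
    have "filterlim h (at 0) sequentially" using h by (auto simp: filterlim_at)
    with DERIV_D[OF d] show ?thesis by (rule filterlim_compose)
  qed
  have "(\<lambda>n. q (w + h n)) \<longlonglongrightarrow> q w"
  proof -
    have "isCont q w" using d by (rule DERIV_isCont)
    moreover have "(\<lambda>n. w + h n) \<longlonglongrightarrow> w" using tendsto_add[OF tendsto_const h(1)] by simp
    ultimately show ?thesis by (rule isCont_tendsto_compose)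
  qed
  then show "(\<lambda>n. (f (w + h n) - f w) / h n) \<longlonglongrightarrow> deriv f w"
    by (simp add: qh) (simp add: q_def)
  have "(\<lambda>n. (q (w + h n) - q w) / h n - (q (w + h (Suc n)) - q w) / h (Suc n) / 2) \<longlonglongrightarrow> d - d / 2"
    by (intro tendsto_intros lim LIMSEQ_Suc[OF lim]) auto
  also have "(\<lambda>n. (q (w + h n) - q w) / h n - (q (w + h (Suc n)) - q w) / h (Suc n) / 2) =
     (\<lambda>n. (q (w + h n) - q (w + h (Suc n))) / h n)"
    using h(2) by (simp add: h(3) fun_eq_iff field_simps)
  finally have "bounded (range (\<lambda>n. (q (w + h n) - q (w + h (Suc n))) / h n))"
    by (rule convergent_imp_bounded)
  then show "bounded (range (\<lambda>n. ((f (w + h n) - f w) / h n - (f (w + h (Suc n)) - f w) / h (Suc n)) / h n))"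
    by (simp add: qh)
qed

definition kernel_vector :: "(complex \<Rightarrow> complex \<Rightarrow> complex) \<Rightarrow> complex \<Rightarrow> complex \<Rightarrow> complex" where
  "kernel_vector K w = restrict_disc (\<lambda>z. K z w)"

lemma kernel_vector:
  assumes "is_rkhs K F" "w \<in> \<bbbD>"
  shows "kernel_vector K w \<in> carrier F" "f \<in> carrier F \<Longrightarrow> ip F f (kernel_vector K w) = f w"
  using assms by (auto simp: is_rkhs_def kernel_vector_def)

text \<open>
  The difference quotients \<open>x n\<close> of the kernel vectors represent difference quotients of functions.
  Their rescaled increments \<open>y n\<close> are weakly bounded, because two derivatives of each \<open>f\<close> exist, hence
  bounded in norm; so the increments of \<open>x n\<close> decay geometrically.
\<close>
lemma derivative_evaluation_vector:
  assumes rk: "is_rkhs K F" and w: "w \<in> \<bbbD>"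
  shows "\<exists>d\<in>carrier F. \<forall>f\<in>carrier F. ip F f d = deriv f w"
proof -
  interpret complex_hilbert_space F using rk by (simp add: is_rkhs_def)
  note kv = kernel_vector[OF rk]
  define r where "r = (1 - cmod w) / 2"
  have r: "r > 0" using w by (simp add: r_def)
  \<comment> \<open>The steps \<open>h n\<close> are real, so no conjugates appear in the scalars of the difference quotients.\<close>
  define h where "h n = r * (1/2) ^ n" for n
  have h0: "h n > 0" for n using r by (simp add: h_def)
  have in_disc: "w + of_real (h n) \<in> \<bbbD>" for n
  proof -
    have "h n \<le> r * 1" unfolding h_def using r by (intro mult_left_mono power_le_one) auto
    then have "cmod w + h n < 1" using w r by (simp add: r_def field_simps)
    moreover have "cmod (w + of_real (h n)) \<le> cmod w + h n"
      using norm_triangle_ineq[of w "of_real (h n)"] h0[of n] by simp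
    ultimately show ?thesis by simp
  qed
  have hlim: "(\<lambda>n. complex_of_real (h n)) \<longlonglongrightarrow> 0"
  proof -
    have "h \<longlonglongrightarrow> r * 0" unfolding h_def 
      by (intro tendsto_mult tendsto_const LIMSEQ_power_zero) auto
    then show ?thesis using tendsto_of_real[of h 0 sequentially] by simp
  qed
  define x where "x n = smult F (1 / of_real (h n)) (kernel_vector K (w + of_real (h n)) - kernel_vector K w)" for n
  define y where "y n = smult F (1 / of_real (h n)) (x n - x (Suc n))" for n
  have x: "x n \<in> carrier F" for n unfolding x_def by (intro in_carrier kv w in_disc)
  have y: "y n \<in> carrier F" for n unfolding y_def by (intro in_carrier x)
  have ipx: "ip F f (x n) = (f (w + of_real (h n)) - f w) / of_real (h n)" if "f \<in> carrier F" for f n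
    using that w in_disc by (simp add: x_def ip_smult_right ip_diff_right in_carrier kv)
  have ipy: "ip F f (y n) = (ip F f (x n) - ip F f (x (Suc n))) / of_real (h n)" if "f \<in> carrier F" for f n
    using that x by (simp add: y_def ip_smult_right ip_diff_right in_carrier)
  have hol: "f holomorphic_on \<bbbD>" if "f \<in> carrier F" for f
    using rk that by (simp add: is_rkhs_def)
  note quot = holomorphic_difference_quotient_increments[OF hol open_ball w hlim]
  have "\<exists>C. \<forall>n. hnorm F (y n) \<le> C"
  proof (rule uniform_boundedness[OF y])
    fix f assume f: "f \<in> carrier F"
    show "bounded (range (\<lambda>n. ip F f (y n)))"
      unfolding ipy[OF f] ipx[OF f]
      by (rule quot(1)[OF f]) (use h0 in \<open>auto simp: h_def less_imp_neq[symmetric]\<close>)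
  qed
  then obtain C where C: "\<And>n. hnorm F (y n) \<le> C" by blast
  have "hnorm F (x n - x (Suc n)) \<le> (C * r) * (1/2) ^ n" for n
  proof -
    have "hnorm F (x n - x (Suc n)) / h n = hnorm F (y n)"
      using h0[of n] x by (simp add: y_def hnorm_smult in_carrier norm_divide)
    then show ?thesis using C[of n] h0[of n] by (simp add: h_def field_simps)
  qed
  from weak_limit_of_geometric_increments[OF x this]
  obtain d where d: "d \<in> carrier F" "\<And>f. f \<in> carrier F \<Longrightarrow> (\<lambda>n. ip F f (x n)) \<longlonglongrightarrow> ip F f d"
    by blast
  have "ip F f d = deriv f w" if f: "f \<in> carrier F" for f
  proof -
    have "(\<lambda>n. ip F f (x n)) \<longlonglongrightarrow> deriv f w"
      unfolding ipx[OF f]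
      by (rule quot(2)[OF f]) (use h0 in \<open>auto simp: h_def less_imp_neq[symmetric]\<close>)
    then show ?thesis using d(2)[OF f] LIMSEQ_unique by blast
  qed
  then show ?thesis using d(1) by blast
qed

section \<open>Contractions and their defect form\<close>

lemma contraction_norm_le:
  assumes "complex_hilbert_space H" "contraction H T" and x: "x \<in> carrier H"
  shows "hnorm H (T x) \<le> hnorm H x"
proof -
  interpret complex_hilbert_space H by fact
  have lin: "linear_between H H T" and on: "operator_norm H T \<le> 1"
    using assms by (auto simp: contraction_def bounded_operator_def)
  have TH: "T z \<in> carrier H" if "z \<in> carrier H" for z
    using lin that by (auto simp: linear_between_def)
  have scale: "T (smult H c z) = smult H c (T z)" if "z \<in> carrier H" for c z
    using lin that by (auto simp: linear_between_def)
  show ?thesis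
  proof (cases "x = 0")
    case True
    have "T 0 = smult H 0 (T 0)" using scale[OF zero_in_carrier, of 0] by simp
    then show ?thesis using True by simp
  next
    case False
    obtain C where C: "\<And>z. z \<in> carrier H \<Longrightarrow> hnorm H (T z) \<le> C * hnorm H z"
      using assms by (auto simp: contraction_def bounded_operator_def)
    have bdd: "bdd_above ((\<lambda>z. hnorm H (T z)) ` {z \<in> carrier H. hnorm H z \<le> 1})"
    proof (rule bdd_aboveI2)
      fix z assume z: "z \<in> {z \<in> carrier H. hnorm H z \<le> 1}"
      have "hnorm H (T z) \<le> C * hnorm H z" using z C by simp
      also have "\<dots> \<le> \<bar>C\<bar> * hnorm H z" using z by (intro mult_right_mono) (auto simp: hnorm_nonneg)
      also have "\<dots> \<le> \<bar>C\<bar> * 1" using z by (intro mult_left_mono) auto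
      finally show "hnorm H (T z) \<le> \<bar>C\<bar>" by simp
    qed
    have p: "hnorm H x > 0"
      using False x hnorm_nonneg[OF x] hnorm_eq_0_iff[OF x] by linarith
    define z where "z = smult H (of_real (1 / hnorm H x)) x"
    have z: "z \<in> carrier H" "hnorm H z = 1" 
      using x p by (auto simp: z_def in_carrier hnorm_smult norm_divide)
    have "hnorm H (T z) \<le> operator_norm H T"
      unfolding operator_norm_def using z by (intro cSUP_upper[OF _ bdd]) auto
    also have "hnorm H (T z) = hnorm H (T x) / hnorm H x"
      using x p by (simp add: z_def scale hnorm_smult TH norm_divide)
    finally have "hnorm H (T x) / hnorm H x \<le> 1" using on by simp
    then show ?thesis using p by simp
  qed
qed

text \<open>
  Transporting \<open>T\<close> along the unitary shows that \<open>A\<close> is a linear contraction; this is how linearity and the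
  bound become known for an operator, such as \<open>adjoint_op\<close>, that is defined by a description.
\<close>
lemma unitarily_equivalent_contraction:
  assumes H: "complex_hilbert_space H" and T: "contraction H T"
    and ue: "unitarily_equivalent H T F A"
  shows "linear_between F F A" and "\<And>y. y \<in> carrier F \<Longrightarrow> hnorm F (A y) \<le> hnorm F y"
proof -
  interpret complex_hilbert_space H by fact
  obtain U where U: "linear_between H F U" and bij: "bij_betw U (carrier H) (carrier F)"
    and ipU: "\<And>x y. x \<in> carrier H \<Longrightarrow> y \<in> carrier H \<Longrightarrow> ip F (U x) (U y) = ip H x y"
    and AU: "\<And>x. x \<in> carrier H \<Longrightarrow> A (U x) = U (T x)"
    using ue unfolding unitarily_equivalent_def unitary_between_def by metis
  have T': "linear_between H H T" using T by (simp add: contraction_def bounded_operator_def)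
  have T_in: "T x \<in> carrier H" if "x \<in> carrier H" for x
    using T' that by (auto simp: linear_between_def)
  have U_in: "U x \<in> carrier F" if "x \<in> carrier H" for x
    using U that by (auto simp: linear_between_def)
  have surj: "\<exists>x\<in>carrier H. y = U x" if "y \<in> carrier F" for y
    using bij that by (auto simp: bij_betw_def)
  have U_add: "U x + U y = U (x + y)" if "x \<in> carrier H" "y \<in> carrier H" for x y
    using U that by (auto simp: linear_between_def)
  have U_scale: "smult F c (U x) = U (smult H c x)" if "x \<in> carrier H" for c x
    using U that by (auto simp: linear_between_def)
  have T_add: "T (x + y) = T x + T y" if "x \<in> carrier H" "y \<in> carrier H" for x y
    using T' that by (auto simp: linear_between_def)
  have T_scale: "T (smult H c x) = smult H c (T x)" if "x \<in> carrier H" for c x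
    using T' that by (auto simp: linear_between_def)
  show "linear_between F F A"
    unfolding linear_between_def
  proof (intro conjI ballI allI)
    show "A \<in> carrier F \<rightarrow> carrier F" using surj by (force simp: AU T_in U_in)
  next
    fix x y assume "x \<in> carrier F" "y \<in> carrier F"
    then obtain x' y' where "x' \<in> carrier H" "x = U x'" "y' \<in> carrier H" "y = U y'" using surj by metis
    then show "A (x + y) = A x + A y" by (simp add: U_add AU in_carrier T_add T_in)
  next
    fix c x assume "x \<in> carrier F"
    then obtain x' where "x' \<in> carrier H" "x = U x'" using surj by metis
    then show "A (smult F c x) = smult F c (A x)" by (simp add: U_scale AU in_carrier T_scale T_in)
  qed
  fix y assume "y \<in> carrier F"
  then obtain x where x: "x \<in> carrier H" "y = U x" using surj by metis
  have "hnorm F (U z) = hnorm H z" if "z \<in> carrier H" for z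
    using that by (simp add: hnorm_def ipU)
  then show "hnorm F (A y) \<le> hnorm F y"
    using x contraction_norm_le[OF H T] by (simp add: AU T_in)
qed

context complex_hilbert_space
begin

lemma adjoint_op_eqI:
  assumes z: "z \<in> carrier H" "\<And>x. x \<in> carrier H \<Longrightarrow> ip H (A x) y = ip H x z"
  shows "adjoint_op H A y = z"
  unfolding adjoint_op_def
proof (rule the_equality)
  fix z' assume z': "z' \<in> carrier H \<and> (\<forall>x\<in>carrier H. ip H (A x) y = ip H x z')"
  have "ip H (z' - z) (z' - z) = 0"
    using z z' by (simp add: ip_diff_right in_carrier)
  then show "z' = z" using z z' ip_definite[of "z' - z"] by (simp add: in_carrier)
qed (use assms in auto)

text \<open>
  At the combination \<open>s\<close> of the vectors the quadratic form is the squared norm of \<open>s\<close> minus that of \<open>A s\<close>.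
\<close>
lemma nonneg_definite_defect_Gram_matrix:
  assumes A: "linear_between H H A" and contr: "\<And>y. y \<in> carrier H \<Longrightarrow> hnorm H (A y) \<le> hnorm H y"
    and y: "\<And>i. i \<in> I \<Longrightarrow> y i \<in> carrier H"
  shows "nonneg_definite_matrix I (\<lambda>i j. ip H (y j) (y i) - ip H (A (y j)) (A (y i)))"
  unfolding nonneg_definite_matrix_def
proof
  fix c :: "'b \<Rightarrow> complex"
  have A_in: "A x \<in> carrier H" if "x \<in> carrier H" for x
    using A that by (auto simp: linear_between_def)
  have A_add: "A (x + y) = A x + A y" if "x \<in> carrier H" "y \<in> carrier H" for x y
    using A that by (auto simp: linear_between_def)
  have A_scale: "A (smult H c x) = smult H c (A x)" if "x \<in> carrier H" for c x
    using A that by (auto simp: linear_between_def)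
  have A_sum: "A (\<Sum>i\<in>J. f i) = (\<Sum>i\<in>J. A (f i))" if "\<And>i. i \<in> J \<Longrightarrow> f i \<in> carrier H" for J and f :: "'b \<Rightarrow> 'a"
  proof -
    have "A 0 = 0" using A_scale[OF zero_in_carrier, of 0] by simp
    then show ?thesis using that
      by (induction J rule: infinite_finite_induct) (auto simp: A_add in_carrier)
  qed
  have ip_comb: "ip H (\<Sum>i\<in>I. smult H (c i) (z i)) (\<Sum>i\<in>I. smult H (c i) (z i)) = 
      (\<Sum>i\<in>I. \<Sum>j\<in>I. cnj (c i) * ip H (z j) (z i) * c j)" if "\<And>i. i \<in> I \<Longrightarrow> z i \<in> carrier H" for z
    using that by (simp add: ip_sum_left ip_sum_right ip_smult_left ip_smult_right in_carrier
        sum_distrib_left mult_ac cong: sum.cong)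
  define s where "s = (\<Sum>i\<in>I. smult H (c i) (y i))"
  have s: "s \<in> carrier H" unfolding s_def using y by (intro in_carrier)
  have As: "A s = (\<Sum>i\<in>I. smult H (c i) (A (y i)))"
    unfolding s_def using y by (simp add: A_sum A_scale in_carrier cong: sum.cong)
  have "(\<Sum>i\<in>I. \<Sum>j\<in>I. cnj (c i) * (ip H (y j) (y i) - ip H (A (y j)) (A (y i))) * c j) = 
     ip H s s - ip H (A s) (A s)"
    unfolding As unfolding s_def using y A_in
    by (simp add: ip_comb sum_subtractf ring_distribs)
  also have "\<dots> = of_real ((hnorm H s)\<^sup>2 - (hnorm H (A s))\<^sup>2)"
    using s by (simp add: ip_self A_in)
  also have "\<dots> \<in> \<real>\<^sub>\<ge>\<^sub>0"
    unfolding nonneg_Reals_of_real_iff using contr[OF s] s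
    by (simp add: power_mono hnorm_nonneg A_in)
  finally show "(\<Sum>i\<in>I. \<Sum>j\<in>I. cnj (c i) * (ip H (y j) (y i) - ip H (A (y j)) (A (y i))) * c j) \<in> \<real>\<^sub>\<ge>\<^sub>0" .
qed

end

section \<open>Kernel derivatives and the adjoint of multiplication\<close>

text \<open>
  The kernel section at \<open>w\<close> is \<open>kernel_vector K w\<close>, and by the Hermitian symmetry of the inner product the
  function \<open>d w\<close> is \<open>\<lambda>z. delbar K z w\<close>. Every derivative of the kernel is thus an inner product of
  the representing vectors.
\<close>
lemma rkhs_kernel_derivatives:
  assumes rk: "is_rkhs K F" and z: "z \<in> \<bbbD>" and w: "w \<in> \<bbbD>"
    and d: "\<And>w. w \<in> \<bbbD> \<Longrightarrow> d w \<in> carrier F" 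
    and dd: "\<And>w f. w \<in> \<bbbD> \<Longrightarrow> f \<in> carrier F \<Longrightarrow> ip F f (d w) = deriv f w"
  shows "K z w = ip F (kernel_vector K w) (kernel_vector K z)"
    and "del K z w = ip F (kernel_vector K w) (d z)"
    and "delbar K z w = ip F (d w) (kernel_vector K z)"
    and "del (delbar K) z w = ip F (d w) (d z)"
proof -
  interpret complex_hilbert_space F using rk by (simp add: is_rkhs_def)
  let ?k = "kernel_vector K"
  note kv = kernel_vector[OF rk]
  have near: "eventually (\<lambda>u. u \<in> \<bbbD>) (nhds u)" if "u \<in> \<bbbD>" for u :: complex
    using that by (intro eventually_nhds_in_open) auto
  have K: "K z w = ip F (?k w) (?k z)" if "z \<in> \<bbbD>" "w \<in> \<bbbD>" for z w
    using that kv by (simp add: kernel_vector_def restrict_disc_def)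
  show "K z w = ip F (?k w) (?k z)" by (rule K[OF z w])
  have "del K z w = deriv (?k w) z"
    unfolding del_def using near[OF z]
    by (intro deriv_cong_ev) (auto simp: kernel_vector_def restrict_disc_def elim!: eventually_mono)
  then show "del K z w = ip F (?k w) (d z)" using dd[OF z] kv w by simp
  have db: "delbar K z w = ip F (d w) (?k z)" if z: "z \<in> \<bbbD>" and w: "w \<in> \<bbbD>" for z w
  proof -
    have "?k z holomorphic_on \<bbbD>" using rk kv(1)[OF z] by (simp add: is_rkhs_def)
    then have "(?k z has_field_derivative deriv (?k z) w) (at (cnj (cnj w)))"
      using w by (simp add: holomorphic_derivI)
    then have "(cnj \<circ> ?k z \<circ> cnj has_field_derivative cnj (deriv (?k z) w)) (at (cnj w))"
      by (rule has_field_derivative_cnj_cnj)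
    then have "cnj (deriv (?k z) w) = deriv (cnj \<circ> ?k z \<circ> cnj) (cnj w)" by (simp add: DERIV_imp_deriv)
    also have "\<dots> = delbar K z w"
      unfolding delbar_def
    proof (rule deriv_cong_ev)
      have "K z (cnj u) = cnj (?k z (cnj u))" if "u \<in> \<bbbD>" for u
        using K[OF z, of "cnj u"] kv z that ip_cnj[of "?k z" "?k (cnj u)"] by simp
      then show "\<forall>\<^sub>F u in nhds (cnj w). (cnj \<circ> ?k z \<circ> cnj) u = K z (cnj u)"
        using near[of "cnj w"] w by (auto elim!: eventually_mono)
    qed simp
    also have "cnj (deriv (?k z) w) = ip F (d w) (?k z)"
      using dd[OF w kv(1)[OF z]] ip_cnj[OF kv(1)[OF z] d[OF w]] by simp
    finally show ?thesis by simp
  qed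
  show "delbar K z w = ip F (d w) (?k z)" by (rule db[OF z w])
  have "del (delbar K) z w = deriv (d w) z"
    unfolding del_def using near[OF z]
    by (intro deriv_cong_ev) (auto simp: db[OF _ w] kv d[OF w] elim!: eventually_mono)
  then show "del (delbar K) z w = ip F (d w) (d z)" using dd[OF z] d w by simp
qed

text \<open>
  The second equation dualises the product rule for \<open>z f(z)\<close> at \<open>w\<close>.
\<close>
lemma adjoint_mult_z:
  assumes rk: "is_rkhs K F" and M: "bounded_operator F mult_z" and w: "w \<in> \<bbbD>"
    and d: "d \<in> carrier F" "\<And>f. f \<in> carrier F \<Longrightarrow> ip F f d = deriv f w"
  shows "adjoint_op F mult_z (kernel_vector K w) = smult F (cnj w) (kernel_vector K w)"
    and "adjoint_op F mult_z d = kernel_vector K w + smult F (cnj w) d"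
proof -
  interpret complex_hilbert_space F using rk by (simp add: is_rkhs_def)
  note kv = kernel_vector[OF rk w]
  have M_in: "mult_z f \<in> carrier F" if "f \<in> carrier F" for f
    using M that by (auto simp: bounded_operator_def linear_between_def)
  show "adjoint_op F mult_z (kernel_vector K w) = smult F (cnj w) (kernel_vector K w)"
    by (rule adjoint_op_eqI) (auto simp: kv M_in in_carrier ip_smult_right mult_z_def)
  show "adjoint_op F mult_z d = kernel_vector K w + smult F (cnj w) d"
  proof (rule adjoint_op_eqI)
    fix f assume f: "f \<in> carrier F"
    have "f holomorphic_on \<bbbD>" using rk f by (simp add: is_rkhs_def)
    then have "f field_differentiable at w" 
      using w by (meson holomorphic_on_imp_differentiable_at open_ball)
    then have "deriv (mult_z f) w = f w + w * deriv f w"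
      unfolding mult_z_def by (subst deriv_mult) auto
    then show "ip F (mult_z f) d = ip F f (kernel_vector K w + smult F (cnj w) d)"
      using f by (simp add: d kv M_in ip_add_right ip_smult_right in_carrier)
  qed (auto simp: d kv in_carrier)
qed

section \<open>The curvature inequality\<close>

theorem proposition2p2:
  fixes H :: "('a::ab_group_add) hilb"
    and T :: "'a \<Rightarrow> 'a"
    and K :: "complex \<Rightarrow> complex \<Rightarrow> complex"
    and F :: "(complex \<Rightarrow> complex) hilb"
  assumes "complex_hilbert_space H"
    and "separable_space (htopology H)"
    and "cowen_douglas_B1 H T"
    and "contraction H T"
    and "sesqui_analytic K"
    and "nonneg_definite_kernel K"
    and "is_rkhs K F"
    and "bounded_operator F mult_z"
    and "unitarily_equivalent H T F (adjoint_op F mult_z)"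
  shows "(\<lambda>z w. (K z w)\<^sup>2) \<preceq> (\<lambda>z w. szego_kernel z w powi (-2) * curvature_kernel K z w)"
proof -
  note rk = \<open>is_rkhs K F\<close>
  interpret complex_hilbert_space F using rk by (simp add: is_rkhs_def)
  let ?k = "kernel_vector K" and ?A = "adjoint_op F mult_z"
  obtain d where d: "\<And>w. w \<in> \<bbbD> \<Longrightarrow> d w \<in> carrier F"
    and dd: "\<And>w f. w \<in> \<bbbD> \<Longrightarrow> f \<in> carrier F \<Longrightarrow> ip F f (d w) = deriv f w"
    using derivative_evaluation_vector[OF rk] by metis
  note kv = kernel_vector[OF rk]
  note A = unitarily_equivalent_contraction[OF assms(1,4,9)]
  have Ak: "?A (?k w) = smult F (cnj w) (?k w)" "?A (d w) = ?k w + smult F (cnj w) (d w)"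
    if "w \<in> \<bbbD>" for w
    using adjoint_mult_z[OF rk assms(8) that, of "d w"] d dd that by auto
  define D where "D x y = ip F x y - ip F (?A x) (?A y)" for x y
  \<comment> \<open>\<open>D\<close> on these vectors gives \<open>(1 - z * cnj w) * K z w\<close> and its derivatives.\<close>
  have identity: "szego_kernel z w powi (-2) * curvature_kernel K z w - (K z w)\<^sup>2 =
      D (?k w) (?k z) * D (d w) (d z) - D (d w) (?k z) * D (?k w) (d z)"
    if z: "z \<in> \<bbbD>" and w: "w \<in> \<bbbD>" for z w
  proof -
    have Kd: "ip F (?k w) (?k z) = K z w" "ip F (?k w) (d z) = del K z w"
      "ip F (d w) (?k z) = delbar K z w" "ip F (d w) (d z) = del (delbar K) z w"
      using rkhs_kernel_derivatives[OF rk z w, of d] d dd by auto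
    note vec = kv(1)[OF z] kv(1)[OF w] d[OF z] d[OF w]
    have "D (?k w) (?k z) = (1 - z * cnj w) * K z w"
      unfolding D_def Ak(1)[OF z] Ak(1)[OF w] using vec
      by (simp add: ip_smult_left ip_smult_right in_carrier Kd algebra_simps)
    moreover have "D (d w) (?k z) = (1 - z * cnj w) * delbar K z w - z * K z w"
      unfolding D_def Ak(1)[OF z] Ak(2)[OF w] using vec
      by (simp add: ip_add_left ip_smult_left ip_smult_right in_carrier Kd algebra_simps)
    moreover have "D (?k w) (d z) = (1 - z * cnj w) * del K z w - cnj w * K z w"
      unfolding D_def Ak(2)[OF z] Ak(1)[OF w] using vec
      by (simp add: ip_add_right ip_smult_left ip_smult_right in_carrier Kd algebra_simps)
    moreover have "D (d w) (d z) = (1 - z * cnj w) * del (delbar K) z w - K z w - z * del K z w - cnj w * delbar K z w"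
      unfolding D_def Ak(2)[OF z] Ak(2)[OF w] using vec
      by (simp add: ip_add_left ip_add_right ip_smult_left ip_smult_right in_carrier Kd algebra_simps)
    moreover have "szego_kernel z w powi (-2) = (1 - z * cnj w)\<^sup>2"
      by (simp add: szego_kernel_def power_int_minus power_divide)
    ultimately show ?thesis
      by (simp only: curvature_kernel_def) (simp add: power2_eq_square algebra_simps)
  qed
  show ?thesis
    unfolding kernel_le_def nonneg_definite_kernel_def
  proof (intro allI impI)
    fix X :: "complex set" assume X: "finite X \<and> X \<subseteq> \<bbbD>"
    \<comment> \<open>Two vectors per point: the Boolean tag selects the evaluation of the derivative.\<close>
    define y where "y i = (if snd i then d (fst i) else ?k (fst i))" for i
    have "nonneg_definite_matrix (X \<times> UNIV) (\<lambda>i j. D (y j) (y i))"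
      unfolding D_def
      by (rule nonneg_definite_defect_Gram_matrix[OF A]) (use X in \<open>auto simp: y_def kv d\<close>)
    then have "nonneg_definite_matrix X (\<lambda>z w. D (y (w, False)) (y (z, False)) * D (y (w, True)) (y (z, True))
        - D (y (w, True)) (y (z, False)) * D (y (w, False)) (y (z, True)))"
      using X by (intro nonneg_definite_matrix_minors[of "X \<times> UNIV"]) auto
    moreover have "D (y (w, False)) (y (z, False)) * D (y (w, True)) (y (z, True))
        - D (y (w, True)) (y (z, False)) * D (y (w, False)) (y (z, True)) = 
        szego_kernel z w powi (-2) * curvature_kernel K z w - (K z w)\<^sup>2" if "z \<in> X" "w \<in> X" for z w
    proof -
      have "z \<in> \<bbbD>" "w \<in> \<bbbD>" using X that by auto
      from identity[OF this] show ?thesis by (simp add: y_def)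
    qed
    ultimately show "nonneg_definite_matrix X (\<lambda>z w. szego_kernel z w powi (-2) * curvature_kernel K z w - (K z w)\<^sup>2)"
      by (simp add: nonneg_definite_matrix_def cong: sum.cong)
  qed
qed

end
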